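(* Let $(L,\vee,\wedge)$ be a distributive lattice and let $d:L\to L$ be an isotone derivation. Define a binary operation on $L$ by $$x\triangleleft y:=d(x)\wedge y\quad\text{for all }x,y\in L.$$ Then $(L,\vee,\triangleleft)$ is a left Novikov semiring. Moreover, if $L$ has a top element $1$, then $d$ is a homomorphism of Novikov semirings from $(L,\vee,\wedge)$ to $(L,\vee,\triangleleft)$.
   Context: A derivation on a lattice $(L,\vee,\wedge)$ is a map $d:L\to L$ with $d(x\wedge y)=(d(x)\wedge y)\vee(x\wedge d(y))$ for all $x,y\in L$. It is isotone if $x\leq y$ implies $d(x)\leq d(y)$. A triple $(L,\vee,\triangleleft)$ of a set with two binary operations is a (left) Novikov semiring if $\vee$ is commutative and associative, $\triangleleft$ distributes over $\vee$ (on both sides), and for all $x,y,z\in L$: $$((x\triangleleft y)\triangleleft z)\vee((y\triangleleft x)\triangleleft z)=(x\triangleleft(y\triangleleft z))\vee(y\triangleleft(x\triangleleft z)),\qquad (x\triangleleft y)\triangleleft z=(x\triangleleft z)\triangleleft y.$$ Every distributive lattice $(L,\vee,\wedge)$ is a Novikov semiring with $\triangleleft=\wedge$. A homomorphism of Novikov semirings is a map preserving both binary operations. *)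

theory Defs
  imports Main
begin

definition lattice_derivation :: "('a::lattice \<Rightarrow> 'a) \<Rightarrow> bool"
  where "lattice_derivation d \<longleftrightarrow>
    (\<forall>x y. d (inf x y) = sup (inf (d x) y) (inf x (d y)))"

locale left_novikov_semiring = add: abel_semigroup add
  for add :: "'a \<Rightarrow> 'a \<Rightarrow> 'a" (infixl "\<oplus>" 65) +
  fixes mult :: "'a \<Rightarrow> 'a \<Rightarrow> 'a" (infixl "\<lhd>" 70)
  assumes distrib_left: "x \<lhd> (y \<oplus> z) = (x \<lhd> y) \<oplus> (x \<lhd> z)"
    and distrib_right: "(x \<oplus> y) \<lhd> z = (x \<lhd> z) \<oplus> (y \<lhd> z)"
    and left_symmetric:
      "((x \<lhd> y) \<lhd> z) \<oplus> ((y \<lhd> x) \<lhd> z) = (x \<lhd> (y \<lhd> z)) \<oplus> (y \<lhd> (x \<lhd> z))"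
    and right_commute: "(x \<lhd> y) \<lhd> z = (x \<lhd> z) \<lhd> y"

locale left_novikov_semiring_hom =
  source: left_novikov_semiring add1 mult1 + target: left_novikov_semiring add2 mult2
  for add1 mult1 :: "'a \<Rightarrow> 'a \<Rightarrow> 'a" and add2 mult2 :: "'b \<Rightarrow> 'b \<Rightarrow> 'b" +
  fixes f :: "'a \<Rightarrow> 'b"
  assumes hom_add: "f (add1 x y) = add2 (f x) (f y)"
    and hom_mult: "f (mult1 x y) = mult2 (f x) (f y)"

end

theory Submission
  imports Defs
begin

text \<open>
  For an isotone derivation the two joinands of \<open>d (x \<sqinter> y) = (d x \<sqinter> y) \<squnion> (x \<sqinter> d y)\<close> coincide:
  \<open>d x \<le> x\<close> by the Leibniz rule at \<open>x \<sqinter> x\<close>, and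
  \<open>d x \<sqinter> y \<le> d (x \<sqinter> y) \<le> d x \<sqinter> d y \<le> d x \<sqinter> y\<close>.  So \<open>d\<close> is linear over \<open>\<sqinter>\<close>
  (\<open>derivation_inf_left\<close>), hence idempotent (\<open>derivation_idem\<close>), and by
  distributivity it preserves joins (\<open>derivation_sup\<close>).
  With \<open>x \<lhd> y = d x \<sqinter> y\<close>, both bracketings of \<open>x\<close>, \<open>y\<close>, \<open>z\<close> then become the meet
  \<open>d x \<sqinter> d y \<sqinter> z\<close>, and \<open>(x \<lhd> y) \<lhd> z\<close> also equals \<open>d x \<sqinter> y \<sqinter> z\<close>;
  the first fact gives left symmetry, the second right commutativity.
  Idempotence also makes \<open>d\<close> a homomorphism:
  \<open>d x \<lhd> d y = d (d x) \<sqinter> d y = d x \<sqinter> d y = d (x \<sqinter> y)\<close>.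
\<close>

lemma derivation_le:
  assumes "lattice_derivation d"
  shows "d x \<le> x"
proof -
  have "d (inf x x) = sup (inf (d x) x) (inf x (d x))"
    using assms unfolding lattice_derivation_def by blast
  then have "d x = inf (d x) x" by (simp add: inf.commute)
  then show ?thesis by (metis inf.cobounded2)
qed

lemma derivation_inf:
  assumes "lattice_derivation d" and "mono d"
  shows "d (inf x y) = inf (d x) (d y)"
proof (rule antisym)
  show "d (inf x y) \<le> inf (d x) (d y)"
    using assms(2) by (simp add: monoD)
  have "inf (d x) (d y) \<le> inf (d x) y"
    using derivation_le[OF assms(1)] by (simp add: le_infI2)
  also have "\<dots> \<le> d (inf x y)"
    using assms(1) by (simp add: lattice_derivation_def)
  finally show "inf (d x) (d y) \<le> d (inf x y)" .
qed

lemma derivation_inf_left: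
  assumes "lattice_derivation d" and "mono d"
  shows "d (inf x y) = inf (d x) y"
proof (rule antisym)
  have "d (inf x y) = inf (d x) (d y)"
    by (rule derivation_inf[OF assms])
  also have "\<dots> \<le> inf (d x) y"
    using derivation_le[OF assms(1)] by (simp add: le_infI2)
  finally show "d (inf x y) \<le> inf (d x) y" .
  show "inf (d x) y \<le> d (inf x y)"
    using assms(1) by (simp add: lattice_derivation_def)
qed

lemma derivation_idem:
  assumes "lattice_derivation d" and "mono d"
  shows "d (d x) = d x"
proof -
  have "d (d x) = d (inf x (d x))"
    using derivation_le[OF assms(1)] by (simp add: inf.absorb2)
  also have "\<dots> = d x"
    by (simp add: derivation_inf_left[OF assms])
  finally show ?thesis .
qed

text \<open>The element \<open>s = x \<squnion> y\<close> plays the part of a top element for \<open>x\<close> and \<open>y\<close>: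
  linearity gives \<open>d x = d s \<sqinter> x\<close> and \<open>d y = d s \<sqinter> y\<close>, and \<open>d s = d s \<sqinter> (x \<squnion> y)\<close>
  distributes.\<close>

lemma derivation_sup:
  fixes d :: "'a::distrib_lattice \<Rightarrow> 'a"
  assumes "lattice_derivation d" and "mono d"
  shows "d (sup x y) = sup (d x) (d y)"
proof -
  let ?s = "sup x y"
  have x: "d x = inf (d ?s) x"
    using derivation_inf_left[OF assms, of ?s x] by (simp add: inf.absorb2)
  have y: "d y = inf (d ?s) y"
    using derivation_inf_left[OF assms, of ?s y] by (simp add: inf.absorb2)
  have "d ?s = inf (d ?s) ?s"
    using derivation_le[OF assms(1), of ?s] by (simp add: inf.absorb1)
  also have "\<dots> = sup (d x) (d y)"
    unfolding x y by (rule inf_sup_distrib1)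
  finally show ?thesis .
qed

lemma derivation_novikov:
  fixes d :: "'a::distrib_lattice \<Rightarrow> 'a"
  assumes "lattice_derivation d" and "mono d"
  shows "left_novikov_semiring sup (\<lambda>x y. inf (d x) y)"
proof
  fix x y z :: 'a
  show "inf (d x) (sup y z) = sup (inf (d x) y) (inf (d x) z)"
    by (rule inf_sup_distrib1)
  show "inf (d (sup x y)) z = sup (inf (d x) z) (inf (d y) z)"
    by (simp add: derivation_sup[OF assms] inf_sup_distrib2)
  have assoc: "inf (d (inf (d u) v)) z = inf (d u) (inf (d v) z)" for u v
    by (simp add: derivation_inf[OF assms] derivation_idem[OF assms] inf.assoc)
  show "sup (inf (d (inf (d x) y)) z) (inf (d (inf (d y) x)) z)
      = sup (inf (d x) (inf (d y) z)) (inf (d y) (inf (d x) z))"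
    by (simp only: assoc)
  show "inf (d (inf (d x) y)) z = inf (d (inf (d x) z)) y"
    by (simp add: derivation_inf_left[OF assms] inf.assoc inf.commute[of y z])
qed

text \<open>The identity is an isotone derivation whose product \<open>\<lhd>\<close> is the meet itself.\<close>

lemma distrib_lattice_novikov:
  "left_novikov_semiring (sup :: 'a::distrib_lattice \<Rightarrow> 'a \<Rightarrow> 'a) inf"
  using derivation_novikov[of "\<lambda>x::'a. x"]
  by (simp add: lattice_derivation_def mono_def)

theorem proposition4p4:
  fixes d :: "'a::distrib_lattice \<Rightarrow> 'a"
  assumes "lattice_derivation d"
    and "mono d"
  shows "left_novikov_semiring sup (\<lambda>x y. inf (d x) y) \<and>
    ((\<exists>t::'a. \<forall>x. x \<le> t) \<longrightarrow>
      left_novikov_semiring_hom sup inf sup (\<lambda>x y. inf (d x) y) d)"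
proof -
  have "left_novikov_semiring_hom sup inf sup (\<lambda>x y. inf (d x) y) d"
  proof (intro left_novikov_semiring_hom.intro left_novikov_semiring_hom_axioms.intro)
    show "left_novikov_semiring (sup :: 'a \<Rightarrow> 'a \<Rightarrow> 'a) inf"
      by (rule distrib_lattice_novikov)
    show "left_novikov_semiring sup (\<lambda>x y. inf (d x) y)"
      by (rule derivation_novikov[OF assms])
    show "d (sup x y) = sup (d x) (d y)" for x y
      by (rule derivation_sup[OF assms])
    show "d (inf x y) = inf (d (d x)) (d y)" for x y
      by (simp add: derivation_inf[OF assms] derivation_idem[OF assms])
  qed
  with derivation_novikov[OF assms] show ?thesis by blast
qed

end
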